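(* Let $B$ be a bouquet of $n$ circles and let $\ell:H\to B$ be an immersion, where $H$ is a finite connected compressed graph of rank $m$. Then there exists a maximal essential set $\mathcal E\subset H^1$ of $H$ such that $\ell|_{\mathcal E}:\mathcal E\to B^1$ is injective.
   Context: Graphs: a graph $\Gamma$ is a $1$-dimensional CW-complex with vertex set $\Gamma^0$ and edge set $\Gamma^1$ (open $1$-cells), each edge oriented from an origin to a terminus. A morphism sends vertices to vertices and edges homeomorphically to edges (compatibly with origin and terminus); an immersion is a locally injective morphism. A bouquet of $n$ circles is a graph with one vertex and $n$ edges. An immersed graph is a finite graph with a fixed immersion to $B$ (a labelling), and morphisms between immersed graphs are label preserving, i.e. commute with the maps to $B$. Ranks: $\chi(\Gamma)=|\Gamma^0|-|\Gamma^1|$; a finite connected graph has $\mathrm{rank}(\Gamma)=1-\chi(\Gamma)$; the reduced rank of a finite graph with components $\Gamma_i$ is $\widetilde{\mathrm{rank}}(\Gamma)=\sum_i\max\{0,-\chi(\Gamma_i)\}$. Compressed: a connected immersed graph $H\to B$ is compressed if for every connected immersed graph $K\to B$ such that there is a (label preserving) immersion $H\to K$, one has $\mathrm{rank}(H)\le\mathrm{rank}(K)$. Essential sets: $\mathcal E\subset H^1$ is essential if $\widetilde{\mathrm{rank}}(H-\mathcal E)=\widetilde{\mathrm{rank}}(H)-|\mathcal E|$ (open edges removed); it is maximal essential if in addition $|\mathcal E|=\widetilde{\mathrm{rank}}(H)$. *)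

theory Defs
  imports "Graph_Theory.Digraph_Component" "Graph_Theory.Digraph_Isomorphism"
begin

text \<open>
  A graph, as a 1-dimensional CW-complex with oriented edges, is encoded by its combinatorial data:
  a \<open>pre_digraph\<close> satisfying \<open>wf_digraph\<close>. Loops and parallel edges are allowed. Connectedness
  (\<open>Digraph_Component.connected\<close>) ignores the orientation and excludes the empty graph.
\<close>

definition bouquet :: "nat \<Rightarrow> ('a,'b) pre_digraph \<Rightarrow> bool" where
  "bouquet n B \<longleftrightarrow> fin_digraph B \<and> card (verts B) = 1 \<and> card (arcs B) = n"

definition graph_morphism ::
  "('a,'b) pre_digraph \<Rightarrow> ('c,'d) pre_digraph \<Rightarrow> ('a \<Rightarrow> 'c) \<Rightarrow> ('b \<Rightarrow> 'd) \<Rightarrow> bool" where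
  "graph_morphism G K fV fE \<longleftrightarrow> wf_digraph G \<and> wf_digraph K \<and>
     fV ` verts G \<subseteq> verts K \<and> fE ` arcs G \<subseteq> arcs K \<and>
     (\<forall>e \<in> arcs G. tail K (fE e) = fV (tail G e) \<and> head K (fE e) = fV (head G e))"

text \<open>
  The germs of edges at a vertex \<open>v\<close> are the beginnings of the edges leaving \<open>v\<close> together with the
  ends of the edges arriving at \<open>v\<close>. A loop contributes one germ of each kind, hence the disjoint
  sum. A morphism preserves orientations, so it acts on germs summandwise, and it is locally
  injective iff this action is injective at each vertex.
\<close>

definition graph_immersion ::
  "('a,'b) pre_digraph \<Rightarrow> ('c,'d) pre_digraph \<Rightarrow> ('a \<Rightarrow> 'c) \<Rightarrow> ('b \<Rightarrow> 'd) \<Rightarrow> bool" where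
  "graph_immersion G K fV fE \<longleftrightarrow> graph_morphism G K fV fE \<and>
     (\<forall>v \<in> verts G. inj_on (map_sum fE fE) (out_arcs G v <+> in_arcs G v))"

definition immersed_graph ::
  "('c,'d) pre_digraph \<Rightarrow> ('a,'b) pre_digraph \<Rightarrow> ('a \<Rightarrow> 'c) \<Rightarrow> ('b \<Rightarrow> 'd) \<Rightarrow> bool" where
  "immersed_graph B G lV lE \<longleftrightarrow> fin_digraph G \<and> graph_immersion G B lV lE"

definition label_preserving ::
  "('a,'b) pre_digraph \<Rightarrow> ('a \<Rightarrow> 'c) \<Rightarrow> ('b \<Rightarrow> 'd) \<Rightarrow> ('e \<Rightarrow> 'c) \<Rightarrow> ('f \<Rightarrow> 'd) \<Rightarrow>
   ('a \<Rightarrow> 'e) \<Rightarrow> ('b \<Rightarrow> 'f) \<Rightarrow> bool" where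
  "label_preserving G lV lE kV kE fV fE \<longleftrightarrow>
     (\<forall>v \<in> verts G. kV (fV v) = lV v) \<and> (\<forall>e \<in> arcs G. kE (fE e) = lE e)"

definition euler_char :: "('a,'b) pre_digraph \<Rightarrow> int" where
  "euler_char G = int (card (verts G)) - int (card (arcs G))"

definition graph_rank :: "('a,'b) pre_digraph \<Rightarrow> int" where
  "graph_rank G = 1 - euler_char G"

definition graph_components :: "('a,'b) pre_digraph \<Rightarrow> ('a,'b) pre_digraph set" where
  "graph_components G = {C. pre_digraph.max_subgraph G Digraph_Component.connected C}"

definition reduced_rank :: "('a,'b) pre_digraph \<Rightarrow> int" where
  "reduced_rank G = (\<Sum>C \<in> graph_components G. max 0 (- euler_char C))"

text \<open>
  HOL cannot quantify over types inside a definition, so \<open>K\<close> ranges over graphs with vertices and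
  edges in \<open>nat\<close>. Every finite graph is isomorphic to such a graph; \<open>compressedD\<close> below shows that
  nothing is lost.
\<close>

definition compressed ::
  "('c,'d) pre_digraph \<Rightarrow> ('a,'b) pre_digraph \<Rightarrow> ('a \<Rightarrow> 'c) \<Rightarrow> ('b \<Rightarrow> 'd) \<Rightarrow> bool" where
  "compressed B H lV lE \<longleftrightarrow>
     immersed_graph B H lV lE \<and> Digraph_Component.connected H \<and>
     (\<forall>(K :: (nat,nat) pre_digraph) kV kE.
        immersed_graph B K kV kE \<and> Digraph_Component.connected K \<and>
        (\<exists>fV fE. graph_immersion H K fV fE \<and> label_preserving H lV lE kV kE fV fE)
        \<longrightarrow> graph_rank H \<le> graph_rank K)"

lemma inj_on_map_sum_Plus:
  "inj_on (map_sum f g) (A <+> B) \<longleftrightarrow> inj_on f A \<and> inj_on g B"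
proof
  assume inj: "inj_on (map_sum f g) (A <+> B)"
  show "inj_on f A \<and> inj_on g B"
  proof (intro conjI inj_onI)
    fix x y assume "x \<in> A" "y \<in> A" "f x = f y"
    then show "x = y" using inj_onD[OF inj, of "Inl x" "Inl y"] by auto
  next
    fix x y assume "x \<in> B" "y \<in> B" "g x = g y"
    then show "x = y" using inj_onD[OF inj, of "Inr x" "Inr y"] by auto
  qed
next
  assume "inj_on f A \<and> inj_on g B"
  then show "inj_on (map_sum f g) (A <+> B)"
    by (intro inj_onI) (elim PlusE conjE; simp add: inj_on_eq_iff)
qed

lemma compressedD:
  fixes B :: "('c,'d) pre_digraph" and H :: "('a,'b) pre_digraph"
    and K :: "('e,'f) pre_digraph"
  assumes comp: "compressed B H lV lE"
    and K: "immersed_graph B K kV kE" "Digraph_Component.connected K"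
    and f: "graph_immersion H K fV fE" "label_preserving H lV lE kV kE fV fE"
  shows "graph_rank H \<le> graph_rank K"
proof -
  interpret K: fin_digraph K using K(1) by (simp add: immersed_graph_def)
  obtain iV :: "'e \<Rightarrow> nat" where iV: "inj_on iV (verts K)"
    using finite_imp_inj_to_nat_seg[OF K.finite_verts] by blast
  obtain iE :: "'f \<Rightarrow> nat" where iE: "inj_on iE (arcs K)"
    using finite_imp_inj_to_nat_seg[OF K.finite_arcs] by blast
  define jV where "jV = the_inv_into (verts K) iV"
  define jE where "jE = the_inv_into (arcs K) iE"
  have jV: "\<And>v. v \<in> verts K \<Longrightarrow> jV (iV v) = v"
    unfolding jV_def by (rule the_inv_into_f_f[OF iV])
  have jE: "\<And>e. e \<in> arcs K \<Longrightarrow> jE (iE e) = e"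
    unfolding jE_def by (rule the_inv_into_f_f[OF iE])
  define h where "h = \<lparr>iso_verts = iV, iso_arcs = iE,
    iso_head = (\<lambda>e. iV (head K (jE e))), iso_tail = (\<lambda>e. iV (tail K (jE e)))\<rparr>"
  have h: "K.digraph_isomorphism h"
    unfolding K.digraph_isomorphism_def using iV iE jE by (auto simp: h_def K.wf_digraph)
  define L where "L = app_iso h K"
  have L: "verts L = iV ` verts K" "arcs L = iE ` arcs K"
    "tail L = (\<lambda>e. iV (tail K (jE e)))" "head L = (\<lambda>e. iV (head K (jE e)))"
    by (simp_all add: L_def h_def app_iso_def)
  have wfL: "fin_digraph L" by unfold_locales (auto simp: L jE)
  then have wfL': "wf_digraph L" by (simp add: fin_digraph_def)
  have connL: "Digraph_Component.connected L"
    unfolding L_def by (rule K.connectedI_app_iso[OF K(2) h])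
  have KB: "graph_immersion K B kV kE" using K(1) by (simp add: immersed_graph_def)
  have wfH: "wf_digraph H" "wf_digraph B" using f KB
    by (auto simp: graph_immersion_def graph_morphism_def)
  have fK: "\<And>v. v \<in> verts H \<Longrightarrow> fV v \<in> verts K" "\<And>e. e \<in> arcs H \<Longrightarrow> fE e \<in> arcs K"
    "\<And>e. e \<in> arcs H \<Longrightarrow> tail K (fE e) = fV (tail H e) \<and> head K (fE e) = fV (head H e)"
    using f(1) by (auto simp: graph_immersion_def graph_morphism_def)
  have kB: "\<And>v. v \<in> verts K \<Longrightarrow> kV v \<in> verts B" "\<And>e. e \<in> arcs K \<Longrightarrow> kE e \<in> arcs B"
    "\<And>e. e \<in> arcs K \<Longrightarrow> tail B (kE e) = kV (tail K e) \<and> head B (kE e) = kV (head K e)"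
    using KB by (auto simp: graph_immersion_def graph_morphism_def)
  have immL: "immersed_graph B L (kV \<circ> jV) (kE \<circ> jE)"
    unfolding immersed_graph_def graph_immersion_def
  proof (intro conjI ballI)
    show "graph_morphism L B (kV \<circ> jV) (kE \<circ> jE)"
      using wfL' wfH kB by (simp add: graph_morphism_def L jE jV image_subset_iff)
    fix w assume "w \<in> verts L"
    then obtain v where v: "v \<in> verts K" "w = iV v" by (auto simp: L)
    have inj: "inj_on (map_sum kE kE) (out_arcs K v <+> in_arcs K v)"
      using KB v by (simp add: graph_immersion_def)
    have o: "out_arcs L w = iE ` out_arcs K v" and i: "in_arcs L w = iE ` in_arcs K v"
      using v iV by (auto simp: out_arcs_def in_arcs_def L jE inj_on_eq_iff)
    have "inj_on kE (out_arcs K v)" "inj_on kE (in_arcs K v)"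
      using inj by (simp_all add: inj_on_map_sum_Plus)
    moreover have "inj_on (kE \<circ> jE) (iE ` A)" if "inj_on kE A" "A \<subseteq> arcs K" for A
    proof (rule inj_onI)
      fix x y assume "x \<in> iE ` A" "y \<in> iE ` A" and eq: "(kE \<circ> jE) x = (kE \<circ> jE) y"
      then obtain a b where ab: "a \<in> A" "b \<in> A" "x = iE a" "y = iE b" by blast
      then have "kE a = kE b" using eq that(2) by (simp add: jE subsetD)
      then show "x = y" using inj_onD[OF that(1)] ab by blast
    qed
    ultimately show "inj_on (map_sum (kE \<circ> jE) (kE \<circ> jE)) (out_arcs L w <+> in_arcs L w)"
      unfolding o i inj_on_map_sum_Plus by (simp add: out_arcs_def in_arcs_def)
  qed (rule wfL)
  have "graph_immersion H L (iV \<circ> fV) (iE \<circ> fE)"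
    unfolding graph_immersion_def
  proof (intro conjI ballI)
    show "graph_morphism H L (iV \<circ> fV) (iE \<circ> fE)"
      using wfL' wfH fK by (simp add: graph_morphism_def L jE image_subset_iff)
    fix v assume "v \<in> verts H"
    then have inj: "inj_on (map_sum fE fE) (out_arcs H v <+> in_arcs H v)"
      using f(1) by (simp add: graph_immersion_def)
    have sub: "fE ` arcs H \<subseteq> arcs K"
      using fK(2) by blast
    have "inj_on fE (out_arcs H v)" "inj_on fE (in_arcs H v)"
      using inj by (simp_all add: inj_on_map_sum_Plus)
    moreover have "inj_on iE (fE ` out_arcs H v)" "inj_on iE (fE ` in_arcs H v)"
      using sub by (auto simp: out_arcs_def in_arcs_def intro!: inj_on_subset[OF iE])
    ultimately show "inj_on (map_sum (iE \<circ> fE) (iE \<circ> fE)) (out_arcs H v <+> in_arcs H v)"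
      unfolding inj_on_map_sum_Plus by (auto intro: comp_inj_on)
  qed
  moreover have "label_preserving H lV lE (kV \<circ> jV) (kE \<circ> jE) (iV \<circ> fV) (iE \<circ> fE)"
    using f(2) fK by (simp add: label_preserving_def jV jE)
  ultimately have "graph_rank H \<le> graph_rank L"
    using comp immL connL unfolding compressed_def by blast
  also have "graph_rank L = graph_rank K"
    by (simp add: graph_rank_def euler_char_def L card_image iV iE)
  finally show ?thesis .
qed

definition del_arcs :: "('a,'b) pre_digraph \<Rightarrow> 'b set \<Rightarrow> ('a,'b) pre_digraph" where
  "del_arcs G E = G\<lparr>arcs := arcs G - E\<rparr>"

definition essential :: "('a,'b) pre_digraph \<Rightarrow> 'b set \<Rightarrow> bool" where
  "essential H E \<longleftrightarrow> E \<subseteq> arcs H \<and> reduced_rank (del_arcs H E) = reduced_rank H - int (card E)"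

definition maximal_essential :: "('a,'b) pre_digraph \<Rightarrow> 'b set \<Rightarrow> bool" where
  "maximal_essential H E \<longleftrightarrow> essential H E \<and> int (card E) = reduced_rank H"

end

theory Submission
  imports Defs
begin

text \<open>
  The reduced rank of \<open>G\<close> is the maximum of \<open>- euler_char (G \<restriction> W)\<close> over all sets \<open>W\<close> of vertices.
  Hence \<open>r X = reduced_rank H - reduced_rank (H - X)\<close> is the rank function of a matroid on the
  edges (dual to the bicircular matroid when \<open>H\<close> is connected and not a tree), whose bases are the
  maximal essential sets. By the defect form of Rado's theorem a basis with pairwise distinct labels
  exists as soon as, for every set \<open>S\<close> of labels, the subgraph of the edges labelled in \<open>S\<close> has
  reduced rank at most \<open>card S\<close>. Compressedness gives this bound: take \<open>W\<close> attaining the maximum for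
  that subgraph, collapse \<open>W\<close> to one vertex and its edges to at most \<open>card S\<close> loops, and fold the
  result to an immersed graph; if the bound failed, its rank would be smaller than that of \<open>H\<close>.
\<close>

section \<open>Rado's theorem for a matroid rank function\<close>

text \<open>The first five conditions on \<open>r\<close> after finiteness and labelling data aside,
  \<open>hall\<close> is the defect form of Rado's condition. A minimal \<open>X\<close> inheriting
  \<open>hall\<close> has distinct labels: two equally labelled elements would yield two violated
  conditions that submodularity makes contradictory. A minimal subset of \<open>X\<close> of full
  rank is then a basis.\<close>

lemma rado_common_transversal:
  fixes r :: "'b set \<Rightarrow> int" and l :: "'b \<Rightarrow> 'd"
  assumes finA: "finite A" and finI: "finite I" and lI: "l ` A \<subseteq> I"
    and mono: "\<And>X Y. X \<subseteq> Y \<Longrightarrow> Y \<subseteq> A \<Longrightarrow> r X \<le> r Y"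
    and submod: "\<And>X Y. X \<subseteq> A \<Longrightarrow> Y \<subseteq> A \<Longrightarrow> r (X \<union> Y) + r (X \<inter> Y) \<le> r X + r Y"
    and empty: "r {} = 0"
    and unit: "\<And>X e. e \<in> A \<Longrightarrow> X \<subseteq> A \<Longrightarrow> r (insert e X) \<le> r X + 1"
    and hall: "\<And>J. J \<subseteq> I \<Longrightarrow> r A \<le> r {e \<in> A. l e \<in> J} + int (card (I - J))"
  shows "\<exists>E \<subseteq> A. inj_on l E \<and> r E = r A \<and> int (card E) = r A"
proof -
  define good where "good X \<longleftrightarrow> X \<subseteq> A \<and>
    (\<forall>J \<subseteq> I. r A \<le> r {e \<in> X. l e \<in> J} + int (card (I - J)))" for X
  have "good A" using hall by (simp add: good_def)
  then obtain X where X: "good X" and Xmin: "\<And>Y. good Y \<Longrightarrow> card X \<le> card Y"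
    using ex_has_least_nat[of good A card] by blast
  have XA: "X \<subseteq> A" using X by (simp add: good_def)
  have finX: "finite X" using XA finA by (rule finite_subset)
  have bad: "\<exists>J \<subseteq> I. r {e \<in> X - {x}. l e \<in> J} + int (card (I - J)) < r A" if "x \<in> X" for x
  proof -
    have "card (X - {x}) < card X" using that finX by (rule card_Diff1_less[rotated])
    then have "\<not> good (X - {x})" using Xmin[of "X - {x}"] by linarith
    then show ?thesis using XA unfolding good_def by (auto simp: not_le)
  qed
  \<comment> \<open>If \<open>J\<close> avoided the label of \<open>x\<close>, deleting
    \<open>x\<close> would not affect the edges labelled in \<open>J\<close>, and \<open>X\<close>
    itself would violate the condition.\<close>
  have bad': "l x \<in> J"
    if "x \<in> X" "J \<subseteq> I" "r {e \<in> X - {x}. l e \<in> J} + int (card (I - J)) < r A" for x J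
  proof (rule ccontr)
    assume "l x \<notin> J"
    then have "{e \<in> X - {x}. l e \<in> J} = {e \<in> X. l e \<in> J}" by auto
    with that show False using X unfolding good_def by (metis leD)
  qed
  have inj: "inj_on l X"
  proof (rule inj_onI, rule ccontr)
    fix x y assume x: "x \<in> X" and y: "y \<in> X" and eq: "l x = l y" and ne: "x \<noteq> y"
    obtain J where J: "J \<subseteq> I" "r {e \<in> X - {x}. l e \<in> J} + int (card (I - J)) < r A"
      using bad[OF x] by blast
    obtain K where K: "K \<subseteq> I" "r {e \<in> X - {y}. l e \<in> K} + int (card (I - K)) < r A"
      using bad[OF y] by blast
    have xJ: "l x \<in> J" using bad'[OF x J] .
    have xK: "l x \<in> K" using bad'[OF y K] eq by simp
    \<comment> \<open>The union loses nothing, since \<open>y\<close> survives in \<open>?P\<close>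
      and \<open>x\<close> in \<open>?Q\<close>. The intersection misses both, so it is bounded
      through \<open>J \<inter> K - {l x}\<close>, which costs 1. The two strict integer
      inequalities for \<open>J\<close> and \<open>K\<close> gain 2, hence the
      contradiction.\<close>
    let ?P = "{e \<in> X - {x}. l e \<in> J}" and ?Q = "{e \<in> X - {y}. l e \<in> K}"
    have "?P \<union> ?Q = {e \<in> X. l e \<in> J \<union> K}" using ne xJ xK eq by auto
    then have 1: "r A \<le> r (?P \<union> ?Q) + int (card (I - (J \<union> K)))"
      using X J(1) K(1) unfolding good_def by (metis Un_least)
    have "r A \<le> r {e \<in> X. l e \<in> J \<inter> K - {l x}} + int (card (I - (J \<inter> K - {l x})))"
      using X J(1) unfolding good_def by (metis Diff_subset Int_lower1 subset_trans)
    moreover have "r {e \<in> X. l e \<in> J \<inter> K - {l x}} \<le> r (?P \<inter> ?Q)"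
      using XA eq by (intro mono) auto
    moreover have "I - (J \<inter> K - {l x}) = insert (l x) (I - J \<inter> K)"
      using J(1) xJ by auto
    then have "card (I - (J \<inter> K - {l x})) = Suc (card (I - J \<inter> K))"
      using finI xJ xK by simp
    ultimately have 2: "r A \<le> r (?P \<inter> ?Q) + int (card (I - J \<inter> K)) + 1" by simp
    have "(I - J) \<union> (I - K) = I - J \<inter> K" "(I - J) \<inter> (I - K) = I - (J \<union> K)" by auto
    then have 3: "card (I - J) + card (I - K) = card (I - J \<inter> K) + card (I - (J \<union> K))"
      using card_Un_Int[of "I - J" "I - K"] finI by simp
    have "r (?P \<union> ?Q) + r (?P \<inter> ?Q) \<le> r ?P + r ?Q"
      using XA by (intro submod) auto
    then show False using 1 2 3 J(2) K(2) by linarith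
  qed
  have "r A \<le> r {e \<in> X. l e \<in> I} + int (card (I - I))"
    using X unfolding good_def by blast
  moreover have "{e \<in> X. l e \<in> I} = X" using XA lI by auto
  ultimately have "r A \<le> r X" by simp
  then have "r X = r A" using mono[OF XA] by simp
  then obtain E where E: "E \<subseteq> X" "r E = r A"
    and Emin: "\<And>F. F \<subseteq> X \<Longrightarrow> r F = r A \<Longrightarrow> card E \<le> card F"
    using ex_has_least_nat[of "\<lambda>F. F \<subseteq> X \<and> r F = r A" X card] by blast
  have EA: "E \<subseteq> A" and finE: "finite E" using E XA finX by (auto intro: finite_subset)
  have drop: "r (E - {e}) < r E" if "e \<in> E" for e
  proof -
    have "card (E - {e}) < card E" using that finE by (rule card_Diff1_less[rotated])
    then have "r (E - {e}) \<noteq> r A" using Emin[of "E - {e}"] E(1) by auto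
    moreover have "r (E - {e}) \<le> r E" using EA by (intro mono) auto
    ultimately show ?thesis using E(2) by simp
  qed
  \<comment> \<open>By submodularity \<open>e\<close> adds to \<open>F\<close> at least what it adds
    to \<open>E - {e}\<close>, which is positive by minimality of \<open>E\<close>; by
    \<open>unit\<close> it adds at most 1.\<close>
  have "r F = int (card F)" if "finite F" "F \<subseteq> E" for F
    using that
  proof (induction F)
    case empty
    then show ?case using \<open>r {} = 0\<close> by simp
  next
    case (insert e F)
    have "r (insert e F \<union> (E - {e})) + r (insert e F \<inter> (E - {e})) \<le> r (insert e F) + r (E - {e})"
      using insert.prems EA by (intro submod) auto
    moreover have "insert e F \<union> (E - {e}) = E" "insert e F \<inter> (E - {e}) = F"
      using insert.prems insert.hyps by auto
    ultimately have "r F < r (insert e F)" using drop[of e] insert.prems by simp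
    moreover have "r (insert e F) \<le> r F + 1"
      using insert.prems EA by (intro unit) auto
    ultimately show ?case using insert by simp
  qed
  then have "int (card E) = r A" using finE E(2) by simp
  then show ?thesis using E inj EA by (blast intro: inj_on_subset)
qed

section \<open>Connectedness in terms of cuts\<close>

text \<open>A walk leaving \<open>S\<close> uses a crossing edge; conversely, no edge crosses the
  set of vertices reachable from \<open>u\<close>, so this set is everything. Later arguments use
  cuts instead of walks.\<close>

lemma connected_iff_cut:
  assumes "wf_digraph G"
  shows "Digraph_Component.connected G \<longleftrightarrow> verts G \<noteq> {} \<and>
    (\<forall>S \<subseteq> verts G. S \<noteq> {} \<longrightarrow> S \<noteq> verts G \<longrightarrow> (\<exists>e \<in> arcs G. (tail G e \<in> S) \<noteq> (head G e \<in> S)))"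
    (is "_ \<longleftrightarrow> _ \<and> ?cut")
proof -
  interpret wf_digraph G by fact
  let ?R = "rtrancl_on (verts G) ((arcs_ends G)\<^sup>s)"
  have sym: "(tail G e, head G e) \<in> (arcs_ends G)\<^sup>s" "(head G e, tail G e) \<in> (arcs_ends G)\<^sup>s"
    if "e \<in> arcs G" for e
    using that by (auto simp: symcl_def arcs_ends_conv)
  show ?thesis
    unfolding connected_conv
  proof (intro conj_cong refl iffI)
    assume conn: "\<forall>u \<in> verts G. \<forall>v \<in> verts G. (u, v) \<in> ?R"
    show ?cut
    proof (intro allI impI, rule ccontr)
      fix S assume S: "S \<subseteq> verts G" "S \<noteq> {}" "S \<noteq> verts G"
        and no: "\<not> (\<exists>e \<in> arcs G. (tail G e \<in> S) \<noteq> (head G e \<in> S))"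
      obtain u v where uv: "u \<in> S" "v \<in> verts G" "v \<notin> S" using S by blast
      have "(u, v) \<in> ?R" using conn uv S(1) by blast
      then have "v \<in> S"
        by (induction rule: rtrancl_on_induct)
          (use uv no in \<open>auto simp: symcl_def arcs_ends_conv\<close>)
      then show False using uv by simp
    qed
  next
    assume cut: ?cut
    show "\<forall>u \<in> verts G. \<forall>v \<in> verts G. (u, v) \<in> ?R"
    proof (intro ballI)
      fix u v assume u: "u \<in> verts G" and v: "v \<in> verts G"
      let ?S = "{w. (u, w) \<in> ?R}"
      have "?S \<subseteq> verts G" by (auto dest: in_rtrancl_on_in_F)
      moreover have "?S \<noteq> {}" using u by auto
      moreover have "(tail G e \<in> ?S) = (head G e \<in> ?S)" if "e \<in> arcs G" for e
        using sym[OF that] that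
        by (auto intro: rtrancl_on_into_rtrancl_on tail_in_verts head_in_verts)
      ultimately have "?S = verts G" using cut by blast
      then show "(u, v) \<in> ?R" using v by blast
    qed
  qed
qed

text \<open>While \<open>W\<close> is not everything, some edge leaves it. Adjoining the outer end
  of that edge adds one vertex and at least one edge. The growth has to start from a nonempty set:
  the empty one has Euler characteristic 0, a tree has 1.\<close>

lemma euler_char_induce_le_connected:
  assumes "fin_digraph G" and conn: "Digraph_Component.connected G"
    and W: "W \<subseteq> verts G" "W \<noteq> {}"
  shows "- euler_char (G \<restriction> W) \<le> - euler_char G"
  using W
proof (induction "card (verts G - W)" arbitrary: W rule: less_induct)
  case less
  interpret fin_digraph G by fact
  show ?case
  proof (cases "W = verts G")
    case True
    then have "arcs (G \<restriction> W) = arcs G" by auto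
    then show ?thesis using True by (simp add: euler_char_def)
  next
    case False
    then obtain e where e: "e \<in> arcs G" "(tail G e \<in> W) \<noteq> (head G e \<in> W)"
      using conn less.prems connected_iff_cut[OF wf_digraph_axioms] by blast
    define v where "v = (if tail G e \<in> W then head G e else tail G e)"
    have v: "v \<in> verts G" "v \<notin> W" using e by (auto simp: v_def)
    have finW: "finite W" using less.prems(1) finite_verts by (rule finite_subset)
    have "card (verts G - insert v W) < card (verts G - W)"
      using v by (intro psubset_card_mono) auto
    then have "- euler_char (G \<restriction> insert v W) \<le> - euler_char G"
      using v less.prems by (intro less.hyps) auto
    moreover have "card (insert e (arcs (G \<restriction> W))) \<le> card (arcs (G \<restriction> insert v W))"
      using e by (intro card_mono) (auto simp: v_def)
    then have "card (arcs (G \<restriction> W)) + 1 \<le> card (arcs (G \<restriction> insert v W))"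
      using e by auto
    moreover have "card (insert v W) = card W + 1" using v finW by simp
    ultimately show ?thesis by (simp add: euler_char_def)
  qed
qed

section \<open>Components of a finite graph\<close>

text \<open>A cut of the smaller graph is a cut of the larger one and keeps its crossing edge. This
  makes maximal connected subgraphs induced.\<close>

lemma arc_mono_connected: "arc_mono Digraph_Component.connected"
  unfolding arc_mono_def
proof (intro allI impI, elim conjE)
  fix G K :: "('a, 'b) pre_digraph"
  assume c: "Digraph_Component.connected G" and sub: "subgraph G K" and v: "verts G = verts K"
  have wf: "wf_digraph G" "wf_digraph K" "tail G = tail K" "head G = head K" "arcs G \<subseteq> arcs K"
    using sub by (auto simp: subgraph_def compatible_def)
  show "Digraph_Component.connected K"
    using c v wf(3-5) unfolding connected_iff_cut[OF wf(1)] connected_iff_cut[OF wf(2)]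
    by (metis subsetD)
qed

context fin_digraph
begin

lemma component_eq_induce:
  assumes "C \<in> graph_components G"
  shows "C = G \<restriction> verts C" and "verts C \<subseteq> verts G" and "Digraph_Component.connected C"
proof -
  have m: "max_subgraph Digraph_Component.connected C"
    using assms by (simp add: graph_components_def)
  then have "induced_subgraph C G" using arc_mono_connected induced_subgraphI_arc_mono by blast
  then show "C = G \<restriction> verts C" "verts C \<subseteq> verts G"
    by (auto simp: induced_subgraph_def subgraph_def compatible_def induce_subgraph_def)
  show "Digraph_Component.connected C" using m by (simp add: max_subgraph_def)
qed

text \<open>Otherwise adjoining the outer end of \<open>e\<close> would give a strictly larger
  connected subgraph, against the maximality of \<open>C\<close>.\<close>

lemma component_closed:
  assumes C: "C \<in> graph_components G" and e: "e \<in> arcs G"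
  shows "tail G e \<in> verts C \<longleftrightarrow> head G e \<in> verts C"
proof (rule ccontr)
  assume ne: "(tail G e \<in> verts C) \<noteq> (head G e \<in> verts C)"
  note ind = component_eq_induce[OF C]
  define v where "v = (if tail G e \<in> verts C then head G e else tail G e)"
  have v: "v \<in> verts G" "v \<notin> verts C" using e ne by (auto simp: v_def)
  define K where "K = G \<restriction> insert v (verts C)"
  have KG: "subgraph K G" using v ind(2) by (auto simp: K_def intro!: induced_imp_subgraph)
  then have wfK: "wf_digraph K" by (simp add: subgraph_def)
  have CG: "subgraph C G" using C by (simp add: graph_components_def max_subgraph_def)
  then have wfC: "wf_digraph C" by (simp add: subgraph_def)
  have CK: "subgraph C K"
    using CG wfK ind(1) unfolding subgraph_def compatible_def K_def
    by (auto simp: induce_subgraph_def) (metis (no_types, lifting) wf_digraph.head_in_verts wf_digraph.tail_in_verts)+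
  have "Digraph_Component.connected K"
    unfolding connected_iff_cut[OF wfK]
  proof (intro conjI allI impI)
    show "verts K \<noteq> {}" by (simp add: K_def)
    fix S assume S: "S \<subseteq> verts K" "S \<noteq> {}" "S \<noteq> verts K"
    have CA: "arcs C \<subseteq> arcs K" "tail C = tail K" "head C = head K"
      using CK by (auto simp: subgraph_def compatible_def)
    have eK: "e \<in> arcs K" "tail K e = tail G e" "head K e = head G e" using e ne
      by (auto simp: K_def v_def)
    show "\<exists>e \<in> arcs K. (tail K e \<in> S) \<noteq> (head K e \<in> S)"
    \<comment> \<open>A cut that separates \<open>v\<close> from all of \<open>C\<close> is crossed
      by \<open>e\<close>; any other cut splits \<open>verts C\<close> and is crossed by an edge of
      the connected graph \<open>C\<close>.\<close>
    proof (cases "S \<inter> verts C = {} \<or> verts C \<subseteq> S")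
      case True
      then have "(tail G e \<in> S) \<noteq> (head G e \<in> S)"
        using S ne v unfolding K_def v_def by (auto split: if_splits)
      then show ?thesis using eK by metis
    next
      case False
      then obtain a where a: "a \<in> arcs C" "(tail C a \<in> S \<inter> verts C) \<noteq> (head C a \<in> S \<inter> verts C)"
        using ind(3)[unfolded connected_iff_cut[OF wfC]]
        by (metis Int_lower1 Int_lower2)
      moreover have "tail C a \<in> verts C" "head C a \<in> verts C"
        using a wfC by (auto simp: wf_digraph.tail_in_verts wf_digraph.head_in_verts)
      ultimately show ?thesis using CA by auto
    qed
  qed
  moreover have "K \<noteq> C" using v by (metis K_def induce_subgraph_verts insertI1)
  ultimately show False using C CK KG by (auto simp: graph_components_def max_subgraph_def)
qed

text \<open>If \<open>D\<close> met \<open>C\<close> without lying inside it, connectedness of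
  \<open>D\<close> would give an edge with exactly one end in \<open>C\<close>.\<close>

lemma component_subset:
  assumes C: "C \<in> graph_components G" and D: "D \<in> graph_components G"
    and meet: "verts C \<inter> verts D \<noteq> {}"
  shows "verts D \<subseteq> verts C"
proof (rule ccontr)
  assume nsub: "\<not> verts D \<subseteq> verts C"
  have wf: "wf_digraph D" using D by (simp add: graph_components_def max_subgraph_def subgraph_def)
  obtain e where e: "e \<in> arcs D" "(tail D e \<in> verts C \<inter> verts D) \<noteq> (head D e \<in> verts C \<inter> verts D)"
    using component_eq_induce(3)[OF D, unfolded connected_iff_cut[OF wf]] meet nsub
    by (metis Int_lower1 Int_lower2)
  moreover have "tail D e \<in> verts D" "head D e \<in> verts D"
    using e wf by (auto simp: wf_digraph.tail_in_verts wf_digraph.head_in_verts)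
  moreover have "e \<in> arcs G" "tail D = tail G" "head D = head G"
    using e D by (auto simp: graph_components_def max_subgraph_def subgraph_def compatible_def)
  ultimately show False using component_closed[OF C, of e] by auto
qed

lemma component_disjoint:
  assumes C: "C \<in> graph_components G" and D: "D \<in> graph_components G" and ne: "C \<noteq> D"
  shows "verts C \<inter> verts D = {}"
proof (rule ccontr)
  assume "verts C \<inter> verts D \<noteq> {}"
  then have "verts C = verts D"
    using component_subset[OF C D] component_subset[OF D C] by blast
  then show False using ne component_eq_induce(1)[OF C] component_eq_induce(1)[OF D] by simp
qed

text \<open>Among the vertex sets that contain \<open>v\<close> and induce a connected subgraph, one
  of largest size induces a component; \<open>{v}\<close> shows that there are such sets.\<close>

lemma component_exists:
  assumes v: "v \<in> verts G"
  shows "\<exists>C \<in> graph_components G. v \<in> verts C"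
proof -
  let ?P = "\<lambda>S. S \<subseteq> verts G \<and> v \<in> S \<and> Digraph_Component.connected (G \<restriction> S)"
  have wf: "wf_digraph (G \<restriction> S)" for S by auto
  have "?P {v}" using v unfolding connected_iff_cut[OF wf] by auto
  moreover have "\<forall>S. ?P S \<longrightarrow> card S < Suc (card (verts G))" by (auto intro: card_mono simp: less_Suc_eq_le)
  ultimately obtain S where S: "?P S" and max: "\<And>T. ?P T \<Longrightarrow> card T \<le> card S"
    using ex_has_greatest_nat[of ?P "{v}" card "Suc (card (verts G))"] by blast
  have "G \<restriction> S \<in> graph_components G"
    unfolding graph_components_def mem_Collect_eq
  proof (rule max_subgraphI)
    show "subgraph (G \<restriction> S) G" using S by (auto intro!: induced_imp_subgraph)
    show "Digraph_Component.connected (G \<restriction> S)" using S by blast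
    fix K assume K': "G \<restriction> S \<noteq> K" "subgraph (G \<restriction> S) K" "subgraph K G"
    show "\<not> Digraph_Component.connected K"
    proof
      assume "Digraph_Component.connected K"
      note K = K' this
      have sub: "S \<subseteq> verts K" "verts K \<subseteq> verts G" using K by (auto simp: subgraph_def)
      \<comment> \<open>\<open>K\<close> is an arbitrary subgraph, so it is enlarged to an induced
        one before its size is compared with that of \<open>S\<close>.\<close>
      have "Digraph_Component.connected (G \<restriction> verts K)"
        using arc_mono_connected[unfolded arc_mono_def] K(4) subgraph_induce_subgraphI2[OF K(3)]
        by (metis induce_subgraph_verts)
      then have "card (verts K) \<le> card S" using max sub S by blast
      then have eq: "S = verts K"
        using sub by (metis card_seteq finite_subset finite_verts)
      have "K = G \<restriction> S"
        using K(2,3) subgraph_induce_subgraphI2[OF K(3)] eq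
        by (auto simp: subgraph_def compatible_def induce_subgraph_def)
      then show False using K(1) by simp
    qed
  qed
  then show ?thesis using S by (metis induce_subgraph_verts)
qed

lemma finite_components: "finite (graph_components G)"
proof (rule inj_on_finite)
  show "inj_on verts (graph_components G)"
    by (metis (no_types, lifting) component_eq_induce(1) inj_onI)
  show "verts ` graph_components G \<subseteq> Pow (verts G)" using component_eq_induce(2) by blast
qed simp

section \<open>Reduced rank as a maximum over vertex sets\<close>

text \<open>Components partition the vertices, and no edge joins two of them, so the edges inside
  \<open>W\<close> are partitioned as well.\<close>

lemma euler_char_induce_sum:
  assumes W: "W \<subseteq> verts G"
  shows "euler_char (G \<restriction> W) = (\<Sum>C \<in> graph_components G. euler_char (G \<restriction> (W \<inter> verts C)))"
proof -
  have "W = (\<Union>C \<in> graph_components G. W \<inter> verts C)" using W component_exists by blast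
  then have "card W = card (\<Union>C \<in> graph_components G. W \<inter> verts C)" by simp
  also have "\<dots> = (\<Sum>C \<in> graph_components G. card (W \<inter> verts C))"
    using finite_subset[OF W finite_verts]
    by (intro card_UN_disjoint finite_components) (simp, use component_disjoint in blast)
  finally have 1: "card W = (\<Sum>C \<in> graph_components G. card (W \<inter> verts C))" .
  have "arcs (G \<restriction> W) = (\<Union>C \<in> graph_components G. arcs (G \<restriction> (W \<inter> verts C)))"
    using component_exists component_closed W by (fastforce simp: subset_iff)
  then have "card (arcs (G \<restriction> W)) = card (\<Union>C \<in> graph_components G. arcs (G \<restriction> (W \<inter> verts C)))"
    by simp
  also have "\<dots> = (\<Sum>C \<in> graph_components G. card (arcs (G \<restriction> (W \<inter> verts C))))"
    by (intro card_UN_disjoint finite_components) (simp, use component_disjoint in fastforce)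
  finally show ?thesis using 1 by (simp add: euler_char_def sum_subtractf)
qed

text \<open>Componentwise: where \<open>W\<close> misses \<open>C\<close> the contribution is 0,
  elsewhere \<open>euler_char_induce_le_connected\<close> bounds it by that of all of
  \<open>C\<close>.\<close>

lemma euler_char_induce_le_reduced_rank:
  assumes W: "W \<subseteq> verts G"
  shows "- euler_char (G \<restriction> W) \<le> reduced_rank G"
  unfolding euler_char_induce_sum[OF W] reduced_rank_def sum_negf[symmetric]
proof (rule sum_mono)
  fix C assume C: "C \<in> graph_components G"
  note ind = component_eq_induce[OF C]
  show "- euler_char (G \<restriction> (W \<inter> verts C)) \<le> max 0 (- euler_char C)"
  proof (cases "W \<inter> verts C = {}")
    case True
    then show ?thesis by (simp add: euler_char_def)
  next
    case False
    have "subgraph C G" using C by (simp add: graph_components_def max_subgraph_def)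
    then have "fin_digraph C" by (rule fin_digraph_subgraph[OF _])
    then have "- euler_char (C \<restriction> (W \<inter> verts C)) \<le> - euler_char C"
      using ind(3) False by (intro euler_char_induce_le_connected) auto
    moreover have "C \<restriction> (W \<inter> verts C) = G \<restriction> (W \<inter> verts C)"
      by (subst ind(1)) (auto simp: induce_subgraph_def)
    ultimately show ?thesis by simp
  qed
qed

lemma reduced_rank_attained:
  obtains W where "W \<subseteq> verts G" "reduced_rank G = - euler_char (G \<restriction> W)"
proof -
  let ?P = "{C \<in> graph_components G. - euler_char C > 0}"
  \<comment> \<open>The components of negative Euler characteristic enter whole; every other one has
    empty trace and contributes 0, as in the reduced rank.\<close>
  define W where "W = (\<Union>C \<in> ?P. verts C)"
  have W: "W \<subseteq> verts G" using component_eq_induce(2) by (auto simp: W_def)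
  have "reduced_rank G = (\<Sum>C \<in> graph_components G. - euler_char (G \<restriction> (W \<inter> verts C)))"
    unfolding reduced_rank_def
  proof (rule sum.cong[OF refl])
    fix C assume C: "C \<in> graph_components G"
    show "max 0 (- euler_char C) = - euler_char (G \<restriction> (W \<inter> verts C))"
    proof (cases "C \<in> ?P")
      case True
      then have "W \<inter> verts C = verts C" by (auto simp: W_def)
      then show ?thesis using True component_eq_induce(1)[OF C] by simp
    next
      case False
      then have "W \<inter> verts C = {}" using component_disjoint[OF C] C by (auto simp: W_def)
      then show ?thesis using False C by (simp add: euler_char_def)
    qed
  qed
  then have "reduced_rank G = - euler_char (G \<restriction> W)"
    by (simp add: euler_char_induce_sum[OF W] sum_negf)
  then show ?thesis using W that by blast
qed

section \<open>Deleting edges: the matroid axioms\<close>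

lemma fin_digraph_del_arcs: "fin_digraph (Defs.del_arcs G X)"
  by unfold_locales (auto simp: Defs.del_arcs_def)

lemma reduced_rank_nonneg: "0 \<le> reduced_rank G"
  using euler_char_induce_le_reduced_rank[of "{}"] by (simp add: euler_char_def)

text \<open>Let \<open>U\<close> and \<open>W\<close> be optimal for \<open>X\<close> and
  \<open>Y\<close>; test \<open>X \<union> Y\<close> on \<open>U \<inter> W\<close> and
  \<open>X \<inter> Y\<close> on \<open>U \<union> W\<close>. Vertex counts balance exactly. An edge
  in both of the surviving sets survives in the first test graph, an edge in either of them in the
  second.\<close>

lemma reduced_rank_del_arcs_supermodular:
  "reduced_rank (Defs.del_arcs G X) + reduced_rank (Defs.del_arcs G Y)
   \<le> reduced_rank (Defs.del_arcs G (X \<union> Y)) + reduced_rank (Defs.del_arcs G (X \<inter> Y))"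
proof -
  let ?a = "\<lambda>X W. arcs (Defs.del_arcs G X \<restriction> W)"
  obtain U where U: "U \<subseteq> verts G"
    "reduced_rank (Defs.del_arcs G X) = - euler_char (Defs.del_arcs G X \<restriction> U)"
    by (rule fin_digraph.reduced_rank_attained[OF fin_digraph_del_arcs[of X]])
      (auto simp: Defs.del_arcs_def)
  obtain W where W: "W \<subseteq> verts G"
    "reduced_rank (Defs.del_arcs G Y) = - euler_char (Defs.del_arcs G Y \<restriction> W)"
    by (rule fin_digraph.reduced_rank_attained[OF fin_digraph_del_arcs[of Y]])
      (auto simp: Defs.del_arcs_def)
  have 1: "- euler_char (Defs.del_arcs G (X \<union> Y) \<restriction> (U \<inter> W)) \<le> reduced_rank (Defs.del_arcs G (X \<union> Y))"
    using U by (intro fin_digraph.euler_char_induce_le_reduced_rank[OF fin_digraph_del_arcs])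
      (auto simp: Defs.del_arcs_def)
  have 2: "- euler_char (Defs.del_arcs G (X \<inter> Y) \<restriction> (U \<union> W)) \<le> reduced_rank (Defs.del_arcs G (X \<inter> Y))"
    using U W by (intro fin_digraph.euler_char_induce_le_reduced_rank[OF fin_digraph_del_arcs])
      (auto simp: Defs.del_arcs_def)
  have fin: "finite U" "finite W"
    using finite_subset[OF U(1) finite_verts] finite_subset[OF W(1) finite_verts] by simp_all
  have fina: "finite (?a X U)" "finite (?a Y W)" "finite (?a (X \<inter> Y) (U \<union> W))"
    by (auto simp: Defs.del_arcs_def)
  have "card (?a X U) + card (?a Y W) = card (?a X U \<union> ?a Y W) + card (?a X U \<inter> ?a Y W)"
    using fina card_Un_Int by blast
  also have "\<dots> \<le> card (?a (X \<inter> Y) (U \<union> W)) + card (?a (X \<union> Y) (U \<inter> W))"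
    by (intro add_mono card_mono) (auto simp: Defs.del_arcs_def)
  finally show ?thesis
    using 1 2 U(2) W(2) card_Un_Int[OF fin] by (simp add: euler_char_def)
qed

lemma reduced_rank_del_arcs_antimono:
  assumes "X \<subseteq> Y"
  shows "reduced_rank (Defs.del_arcs G Y) \<le> reduced_rank (Defs.del_arcs G X)"
proof -
  obtain W where W: "W \<subseteq> verts G"
    "reduced_rank (Defs.del_arcs G Y) = - euler_char (Defs.del_arcs G Y \<restriction> W)"
    by (rule fin_digraph.reduced_rank_attained[OF fin_digraph_del_arcs[of Y]])
      (auto simp: Defs.del_arcs_def)
  have "card (arcs (Defs.del_arcs G Y \<restriction> W)) \<le> card (arcs (Defs.del_arcs G X \<restriction> W))"
    using assms by (intro card_mono) (auto simp: Defs.del_arcs_def)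
  then have "- euler_char (Defs.del_arcs G Y \<restriction> W) \<le> - euler_char (Defs.del_arcs G X \<restriction> W)"
    by (simp add: euler_char_def)
  also have "\<dots> \<le> reduced_rank (Defs.del_arcs G X)"
    using W by (intro fin_digraph.euler_char_induce_le_reduced_rank[OF fin_digraph_del_arcs])
      (auto simp: Defs.del_arcs_def)
  finally show ?thesis using W by simp
qed

text \<open>A vertex set optimal for \<open>X\<close> loses at most one inner edge when
  \<open>e\<close> is deleted too.\<close>

lemma reduced_rank_del_arcs_insert:
  "reduced_rank (Defs.del_arcs G X) - 1 \<le> reduced_rank (Defs.del_arcs G (insert e X))"
proof -
  obtain W where W: "W \<subseteq> verts G"
    "reduced_rank (Defs.del_arcs G X) = - euler_char (Defs.del_arcs G X \<restriction> W)"
    by (rule fin_digraph.reduced_rank_attained[OF fin_digraph_del_arcs[of X]])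
      (auto simp: Defs.del_arcs_def)
  have "arcs (Defs.del_arcs G (insert e X) \<restriction> W) = arcs (Defs.del_arcs G X \<restriction> W) - {e}"
    by (auto simp: Defs.del_arcs_def)
  then have "card (arcs (Defs.del_arcs G X \<restriction> W)) - 1 \<le> card (arcs (Defs.del_arcs G (insert e X) \<restriction> W))"
    by (metis card_Diff1_le diff_card_le_card_Diff finite.emptyI finite.insertI One_nat_def card.empty card.insert empty_iff)
  then have "- euler_char (Defs.del_arcs G X \<restriction> W) - 1 \<le> - euler_char (Defs.del_arcs G (insert e X) \<restriction> W)"
    by (simp add: euler_char_def)
  also have "\<dots> \<le> reduced_rank (Defs.del_arcs G (insert e X))"
    using W by (intro fin_digraph.euler_char_induce_le_reduced_rank[OF fin_digraph_del_arcs])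
      (auto simp: Defs.del_arcs_def)
  finally show ?thesis using W by simp
qed

end

section \<open>Quotients and folding\<close>

text \<open>The classes of a label preserving quotient are named by vertices and edges of
  \<open>H\<close> itself, so repeated folding stays within the same types. Ends are compared only
  after \<open>f\<close>, because the edge naming a class may have other ends in
  \<open>H\<close>.\<close>

definition quotient_map ::
  "('a,'b) pre_digraph \<Rightarrow> ('b \<Rightarrow> 'd) \<Rightarrow> ('a \<Rightarrow> 'a) \<Rightarrow> ('b \<Rightarrow> 'b) \<Rightarrow> bool" where
  "quotient_map H lE f g \<longleftrightarrow> f ` verts H \<subseteq> verts H \<and> g ` arcs H \<subseteq> arcs H \<and>
     (\<forall>e \<in> arcs H. lE (g e) = lE e \<and>
        f (tail H (g e)) = f (tail H e) \<and> f (head H (g e)) = f (head H e))"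

definition quotient_graph ::
  "('a,'b) pre_digraph \<Rightarrow> ('a \<Rightarrow> 'a) \<Rightarrow> ('b \<Rightarrow> 'b) \<Rightarrow> ('a,'b) pre_digraph" where
  "quotient_graph H f g = \<lparr>verts = f ` verts H, arcs = g ` arcs H, tail = f \<circ> tail H, head = f \<circ> head H\<rparr>"

lemma fin_digraph_quotient:
  assumes "fin_digraph H" and "quotient_map H lE f g"
  shows "fin_digraph (quotient_graph H f g)"
proof -
  interpret fin_digraph H by fact
  show ?thesis
    using assms(2) by unfold_locales (auto simp: quotient_graph_def quotient_map_def)
qed

text \<open>A cut of the quotient pulls back along \<open>f\<close> to a cut of \<open>H\<close>; if
  \<open>e\<close> crosses the latter, \<open>g e\<close> crosses the former.\<close>

lemma connected_quotient:
  assumes "fin_digraph H" and q: "quotient_map H lE f g" and conn: "Digraph_Component.connected H"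
  shows "Digraph_Component.connected (quotient_graph H f g)"
proof -
  interpret fin_digraph H by fact
  let ?Q = "quotient_graph H f g"
  have wf: "wf_digraph ?Q" using fin_digraph_quotient[OF assms(1) q] by (simp add: fin_digraph_def)
  show ?thesis
    unfolding connected_iff_cut[OF wf]
  proof (intro conjI allI impI)
    show "verts ?Q \<noteq> {}"
      using conn connected_iff_cut[OF wf_digraph_axioms] by (simp add: quotient_graph_def)
    fix S assume S: "S \<subseteq> verts ?Q" "S \<noteq> {}" "S \<noteq> verts ?Q"
    let ?T = "{v \<in> verts H. f v \<in> S}"
    have "?T \<noteq> {}" "?T \<noteq> verts H" using S by (auto simp: quotient_graph_def)
    then obtain e where e: "e \<in> arcs H" "(tail H e \<in> ?T) \<noteq> (head H e \<in> ?T)"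
      using conn[unfolded connected_iff_cut[OF wf_digraph_axioms]]
      by (metis (no_types, lifting) mem_Collect_eq subsetI)
    then have "(f (tail H e) \<in> S) \<noteq> (f (head H e) \<in> S)" by auto
    then show "\<exists>a \<in> arcs ?Q. (tail ?Q a \<in> S) \<noteq> (head ?Q a \<in> S)"
      using e(1) q by (auto simp: quotient_graph_def quotient_map_def)
  qed
qed

text \<open>If a quotient is not immersed, two equally labelled edges share an end and can be folded
  together; a fold loses one edge and at most one vertex, so it does not increase the rank.\<close>

lemma compressed_rank_le_quotient:
  fixes B :: "('c,'d) pre_digraph" and H :: "('a,'b) pre_digraph"
  assumes B: "bouquet n B" and comp: "compressed B H lV lE" and q: "quotient_map H lE f g"
  shows "graph_rank H \<le> graph_rank (quotient_graph H f g)"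
  using q
proof (induction "card (g ` arcs H)" arbitrary: f g rule: less_induct)
  case less
  let ?Q = "quotient_graph H f g"
  note q = less.prems
  have imm: "graph_immersion H B lV lE" and conn: "Digraph_Component.connected H"
    and finH: "fin_digraph H"
    using comp by (auto simp: compressed_def immersed_graph_def)
  interpret fin_digraph H by fact
  interpret B: fin_digraph B using B by (simp add: bouquet_def)
  have finQ: "fin_digraph ?Q" by (rule fin_digraph_quotient[OF finH q])
  then have wfQ: "wf_digraph ?Q" by (simp add: fin_digraph_def)
  obtain b where b: "verts B = {b}" using B by (auto simp: bouquet_def card_1_singleton_iff)
  have lH: "\<And>v. v \<in> verts H \<Longrightarrow> lV v = b" "\<And>e. e \<in> arcs H \<Longrightarrow> lE e \<in> arcs B"
    and bB: "\<And>e. e \<in> arcs B \<Longrightarrow> tail B e = b \<and> head B e = b"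
    using imm b B.tail_in_verts B.head_in_verts
    by (auto simp: graph_immersion_def graph_morphism_def)
  have qD: "\<And>v. v \<in> verts H \<Longrightarrow> f v \<in> verts H" "\<And>e. e \<in> arcs H \<Longrightarrow> g e \<in> arcs H"
    "\<And>e. e \<in> arcs H \<Longrightarrow> lE (g e) = lE e"
    "\<And>e. e \<in> arcs H \<Longrightarrow> f (tail H (g e)) = f (tail H e)"
    "\<And>e. e \<in> arcs H \<Longrightarrow> f (head H (g e)) = f (head H e)"
    using q by (auto simp: quotient_map_def)
  \<comment> \<open>One fold: \<open>v\<close> is merged into \<open>u\<close> and \<open>e'\<close>
    into \<open>e\<close>, where \<open>t\<close> and \<open>h\<close> say that the ends of the two
    edges then agree. For \<open>u = v\<close> only the edges are identified. The edge count drops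
    by exactly one, so the induction hypothesis applies.\<close>
  have fold: "graph_rank H \<le> graph_rank ?Q"
    if e: "e \<in> g ` arcs H" "e' \<in> g ` arcs H" "e \<noteq> e'" "lE e = lE e'"
      and uv: "u \<in> f ` verts H" "v \<in> f ` verts H"
      and t: "(id(v := u)) (f (tail H e)) = (id(v := u)) (f (tail H e'))"
      and h: "(id(v := u)) (f (head H e)) = (id(v := u)) (f (head H e'))" for e e' u v
  proof -
    define p where "p = id(v := u)"
    define f' g' where "f' = p \<circ> f" and "g' = id(e' := e) \<circ> g"
    note t = t[folded p_def] and h = h[folded p_def]
    have q': "quotient_map H lE f' g'"
      unfolding quotient_map_def
    proof (intro conjI ballI)
      show "f' ` verts H \<subseteq> verts H" using qD(1) uv by (auto simp: f'_def p_def)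
      show "g' ` arcs H \<subseteq> arcs H" using qD(2) e by (auto simp: g'_def)
      fix a assume a: "a \<in> arcs H"
      show "lE (g' a) = lE a" using qD(3)[OF a] e by (auto simp: g'_def)
      show "f' (tail H (g' a)) = f' (tail H a)"
        using qD(4)[OF a] t by (cases "g a = e'") (simp_all add: f'_def g'_def)
      show "f' (head H (g' a)) = f' (head H a)"
        using qD(5)[OF a] h by (cases "g a = e'") (simp_all add: f'_def g'_def)
    qed
    have "g' ` arcs H = g ` arcs H - {e'}"
      using e by (auto simp: g'_def)
    then have cg: "card (g ` arcs H) = Suc (card (g' ` arcs H))"
      using e(2) card.remove[of "g ` arcs H" e'] by simp
    have "f ` verts H - {v} \<subseteq> f' ` verts H" by (auto simp: f'_def p_def image_iff)
    then have "card (f ` verts H - {v}) \<le> card (f' ` verts H)" by (intro card_mono) auto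
    then have cf: "card (f ` verts H) \<le> Suc (card (f' ` verts H))"
      using uv by (simp add: card_Diff_singleton)
    have "graph_rank H \<le> graph_rank (quotient_graph H f' g')"
      using cg q' by (intro less.hyps) auto
    then show ?thesis using cf cg by (simp add: graph_rank_def euler_char_def quotient_graph_def)
  qed
  show ?case
  \<comment> \<open>The case condition says that the labelling of the quotient is locally injective,
    that is, that no fold is possible.\<close>
  proof (cases "\<forall>e \<in> g ` arcs H. \<forall>e' \<in> g ` arcs H. lE e = lE e' \<longrightarrow>
      f (tail H e) = f (tail H e') \<or> f (head H e) = f (head H e') \<longrightarrow> e = e'")
    case False
    then obtain e e' where e: "e \<in> g ` arcs H" "e' \<in> g ` arcs H" "e \<noteq> e'" "lE e = lE e'"
      and or: "f (tail H e) = f (tail H e') \<or> f (head H e) = f (head H e')" by blast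
    have ends: "e \<in> arcs H" "e' \<in> arcs H" using e qD(2) by auto
    from or show ?thesis
    proof
      assume t: "f (tail H e) = f (tail H e')"
      show ?thesis
        by (rule fold[OF e, of "f (head H e)" "f (head H e')"]) (use t ends in auto)
    next
      assume h: "f (head H e) = f (head H e')"
      show ?thesis
        by (rule fold[OF e, of "f (tail H e)" "f (tail H e')"]) (use h ends in auto)
    qed
  next
    case True
    have "graph_immersion ?Q B (\<lambda>_. b) lE"
      unfolding graph_immersion_def inj_on_map_sum_Plus
    proof (intro conjI ballI)
      show "graph_morphism ?Q B (\<lambda>_. b) lE"
        using wfQ B.wf_digraph_axioms b bB lH(2) qD(2)
        by (simp add: graph_morphism_def quotient_graph_def image_subset_iff)
      fix v
      have out: "e \<in> g ` arcs H \<and> f (tail H e) = v" if "e \<in> out_arcs ?Q v" for e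
        using that by (simp add: quotient_graph_def)
      show "inj_on lE (out_arcs ?Q v)"
        using True by (intro inj_onI) (metis out)
      have into: "e \<in> g ` arcs H \<and> f (head H e) = v" if "e \<in> in_arcs ?Q v" for e
        using that by (simp add: quotient_graph_def)
      show "inj_on lE (in_arcs ?Q v)"
        using True by (intro inj_onI) (metis into)
    qed
    then have Q: "immersed_graph B ?Q (\<lambda>_. b) lE" using finQ by (simp add: immersed_graph_def)
    \<comment> \<open>\<open>lE\<close> is locally injective on \<open>H\<close> and factors through
      \<open>g\<close>, so \<open>g\<close> is locally injective too. Thus the quotient competes
      with \<open>H\<close> in the definition of compressed.\<close>
    have "graph_immersion H ?Q f g"
      unfolding graph_immersion_def inj_on_map_sum_Plus
    proof (intro conjI ballI)
      show "graph_morphism H ?Q f g"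
        using wfQ wf_digraph_axioms qD(4,5)
        by (simp add: graph_morphism_def quotient_graph_def image_subset_iff)
      fix v assume "v \<in> verts H"
      then have inj: "inj_on lE (out_arcs H v)" "inj_on lE (in_arcs H v)"
        using imm by (simp_all add: graph_immersion_def inj_on_map_sum_Plus)
      show "inj_on g (out_arcs H v)"
        using inj(1) qD(3) by (metis (no_types, lifting) in_out_arcs_conv inj_on_def)
      show "inj_on g (in_arcs H v)"
        using inj(2) qD(3) by (metis (no_types, lifting) in_in_arcs_conv inj_on_def)
    qed
    moreover have "label_preserving H lV lE (\<lambda>_. b) lE f g"
      using lH qD by (simp add: label_preserving_def)
    ultimately show ?thesis
      using compressedD[OF comp Q connected_quotient[OF finH q conn]] by blast
  qed
qed

section \<open>The rank bound for compressed graphs\<close>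

text \<open>This supplies the condition \<open>hall\<close>: deleting the labels in \<open>J\<close>
  leaves only those in \<open>I - J\<close>. Collapsing \<open>W\<close> loses
  \<open>card W - 1\<close> vertices and at least \<open>card X - card (I - J)\<close> edges; since
  the rank cannot fall, \<open>card X - card W\<close> is below \<open>card (I - J)\<close>.\<close>

lemma compressed_reduced_rank_le:
  fixes B :: "('c,'d) pre_digraph" and H :: "('a,'b) pre_digraph"
  assumes B: "bouquet n B" and comp: "compressed B H lV lE"
    and I: "finite I" "lE ` arcs H \<subseteq> I"
  shows "reduced_rank (Defs.del_arcs H {e \<in> arcs H. lE e \<in> J}) \<le> int (card (I - J))"
proof -
  have finH: "fin_digraph H" using comp by (auto simp: compressed_def immersed_graph_def)
  interpret fin_digraph H by fact
  let ?G = "Defs.del_arcs H {e \<in> arcs H. lE e \<in> J}"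
  interpret G: fin_digraph ?G by (rule fin_digraph_del_arcs)
  obtain W where "W \<subseteq> verts ?G" and W: "reduced_rank ?G = - euler_char (?G \<restriction> W)"
    by (rule G.reduced_rank_attained)
  then have WV: "W \<subseteq> verts H" by (simp add: Defs.del_arcs_def)
  have finW: "finite W" using WV finite_verts by (rule finite_subset)
  define X where "X = arcs (?G \<restriction> W)"
  have X: "X \<subseteq> arcs H" "\<And>e. e \<in> X \<Longrightarrow> lE e \<in> I - J" "\<And>e. e \<in> X \<Longrightarrow> tail H e \<in> W \<and> head H e \<in> W"
    using I by (auto simp: X_def Defs.del_arcs_def)
  have finX: "finite X" using X(1) finite_arcs by (rule finite_subset)
  show ?thesis
  proof (cases "W = {}")
    case True
    then show ?thesis using W by (simp add: euler_char_def)
  next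
    case False
    then obtain w where w: "w \<in> W" by blast
    \<comment> \<open>One edge of \<open>X\<close> is chosen for each label occurring there. Once
      \<open>f\<close> sends \<open>W\<close> to \<open>w\<close>, all edges of \<open>X\<close> are
      loops at \<open>w\<close>, so equally labelled ones may be identified.\<close>
    define rep where "rep l = (SOME e. e \<in> X \<and> lE e = l)" for l
    have rep: "rep (lE e) \<in> X \<and> lE (rep (lE e)) = lE e" if "e \<in> X" for e
      unfolding rep_def using someI_ex[of "\<lambda>a. a \<in> X \<and> lE a = lE e"] that by blast
    define f g where "f v = (if v \<in> W then w else v)" and "g e = (if e \<in> X then rep (lE e) else e)" for v e
    have "quotient_map H lE f g"
      unfolding quotient_map_def f_def g_def using X rep WV w by auto
    then have le: "graph_rank H \<le> graph_rank (quotient_graph H f g)"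
      by (rule compressed_rank_le_quotient[OF B comp])
    have "f ` verts H = insert w (verts H - W)" using w WV by (auto simp: f_def)
    then have "card (f ` verts H) = Suc (card (verts H) - card W)"
      using w finW WV by (simp add: card_Diff_subset)
    moreover have "card W \<le> card (verts H)" using WV by (simp add: card_mono)
    ultimately have cf: "card (f ` verts H) + card W = Suc (card (verts H))" by simp
    have "g ` arcs H \<subseteq> (arcs H - X) \<union> rep ` (I - J)" using X(2) by (auto simp: g_def)
    then have "card (g ` arcs H) \<le> card ((arcs H - X) \<union> rep ` (I - J))"
      using I(1) by (intro card_mono) auto
    also have "\<dots> \<le> card (arcs H - X) + card (rep ` (I - J))" by (rule card_Un_le)
    also have "\<dots> \<le> card (arcs H - X) + card (I - J)"
      using I(1) by (simp add: card_image_le)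
    finally have "card (g ` arcs H) + card X \<le> card (arcs H) + card (I - J)"
      using X(1) finX card_mono[OF finite_arcs X(1)] by (simp add: card_Diff_subset)
    then have "int (card X) - int (card W) \<le> int (card (I - J))"
      using le cf by (simp add: graph_rank_def euler_char_def quotient_graph_def)
    then show ?thesis using W by (simp add: euler_char_def X_def)
  qed
qed

section \<open>Existence of an injectively labelled basis\<close>

theorem theorem3p24:
  fixes B :: "('c,'d) pre_digraph" and H :: "('a,'b) pre_digraph"
    and lV :: "'a \<Rightarrow> 'c" and lE :: "'b \<Rightarrow> 'd" and n m :: nat
  assumes "bouquet n B"
    and "fin_digraph H"
    and "Digraph_Component.connected H"
    and "graph_immersion H B lV lE"
    and "compressed B H lV lE"
    and "graph_rank H = int m"
  shows "\<exists>E. maximal_essential H E \<and> inj_on lE E"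
proof -
  interpret fin_digraph H by fact
  define r where "r X = reduced_rank H - reduced_rank (Defs.del_arcs H X)" for X
  \<comment> \<open>With \<open>J\<close> the set of all labels the bound is 0; hence
    \<open>r (arcs H)\<close> is the full reduced rank.\<close>
  have del_all: "reduced_rank (Defs.del_arcs H (arcs H)) = 0"
  proof -
    have "{e \<in> arcs H. lE e \<in> lE ` arcs H} = arcs H" by auto
    then show ?thesis
      using compressed_reduced_rank_le[OF assms(1,5), of "lE ` arcs H" "lE ` arcs H"]
        fin_digraph.reduced_rank_nonneg[OF fin_digraph_del_arcs[of "arcs H"]] by simp
  qed
  then have rA: "r (arcs H) = reduced_rank H" by (simp add: r_def)
  have "\<exists>E \<subseteq> arcs H. inj_on lE E \<and> r E = r (arcs H) \<and> int (card E) = r (arcs H)"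
  proof (rule rado_common_transversal[where I = "lE ` arcs H"])
    show "r X \<le> r Y" if "X \<subseteq> Y" for X Y
      using reduced_rank_del_arcs_antimono[OF that] by (simp add: r_def)
    show "r (X \<union> Y) + r (X \<inter> Y) \<le> r X + r Y" for X Y
      using reduced_rank_del_arcs_supermodular[of X Y] by (simp add: r_def)
    show "r {} = 0" by (simp add: r_def Defs.del_arcs_def)
    show "r (insert e X) \<le> r X + 1" for e X
      using reduced_rank_del_arcs_insert[of X e] by (simp add: r_def)
    show "r (arcs H) \<le> r {e \<in> arcs H. lE e \<in> J} + int (card (lE ` arcs H - J))" for J
      using compressed_reduced_rank_le[OF assms(1,5), of "lE ` arcs H" J] by (simp add: rA, simp add: r_def)
  qed auto
  then obtain E where "E \<subseteq> arcs H" "inj_on lE E" "r E = reduced_rank H" "int (card E) = reduced_rank H"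
    unfolding rA by blast
  \<comment> \<open>Full \<open>r E\<close> means that removing \<open>E\<close> leaves reduced rank
    0, which equals \<open>reduced_rank H - int (card E)\<close>.\<close>
  then show ?thesis by (auto simp: maximal_essential_def essential_def r_def)
qed

end
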